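(* Let $\sigma,\tau,w$ on the fundamental interval $(a,b)$ and the complementary polynomials ${\cal P}_\nu(x;l)$ be as in the context. The polynomials ${\cal P}_\nu(x;l)$ satisfy the following recursion relations, for integers $\nu\ge0$ and $l\ge0$ ($l\ge1$ in (2), where $l-1$ occurs as a parameter of the polynomials), where terms with a negative index $\nu-1$ or $\nu-2$ are read as $0$ and primes denote derivatives in $x$: (1) $${\cal P}_{\nu+1}(x;l)=[\tau(x)+(l-1-\nu)\sigma'(x)]{\cal P}_{\nu}(x;l)+\nu\sigma(x)\big[\tau'+(l-1-\tfrac12(\nu-1))\sigma''\big]{\cal P}_{\nu-1}(x;l);$$ (2) $${\cal P}_{\nu+1}(x;l)=[\tau(x)+(l-1)\sigma'(x)]{\cal P}_{\nu}(x;l-1)+\nu\sigma(x)[\tau'+(l-1)\sigma'']{\cal P}_{\nu-1}(x;l-1)$$ $$={\cal P}_1(x;l){\cal P}_\nu(x;l-1)+\nu\sigma(x){\cal P}_1'(x;l){\cal P}_{\nu-1}(x;l-1);$$ (3) $$\tfrac12\nu(\nu-1)\sigma''\sigma(x)\frac{d{\cal P}_{\nu-2}(x;l)}{dx}+\nu\sigma'(x)\frac{d{\cal P}_{\nu-1}(x;l)}{dx}+\frac{d{\cal P}_{\nu}(x;l)}{dx}$$ $$=\nu[\tau'+(l-1)\sigma'']{\cal P}_{\nu-1}(x;l)+\nu(\nu-1){\cal P}_{\nu-2}(x;l)\Big\{\sigma'(x)[\tau'+(l-1)\sigma'']-\tfrac12\sigma''[\tau(x)+(l-1)\sigma'(x)]\Big\}$$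 $$=\nu{\cal P}_1'(x;l){\cal P}_{\nu-1}(x;l)+\nu(\nu-1){\cal P}_{\nu-2}(x;l)\Big\{\sigma'(x){\cal P}_1'(x;l)-\tfrac12\sigma''{\cal P}_1(x;l)\Big\}.$$
   Context: $\sigma(x)=ex^2+2fx+g$ is a real polynomial of degree at most $2$ and $\tau(x)=a_l+b_lx$ is a real polynomial of degree at most $1$, whose coefficients may depend on $l$. The weight function $w$, possibly dependent on $l$, lives on the fundamental interval $(a,b)$, which contains no zero of $\sigma$; $w$ is nonvanishing there and satisfies Pearson's equation $\sigma(x)w'(x)=[\tau(x)-\sigma'(x)]w(x)$. With $P_l(x)=\frac{1}{w(x)}\frac{d^l}{dx^l}(\sigma(x)^lw(x))$, the complementary polynomials are introduced by $P_l(x)=\frac{1}{w(x)}\frac{d^{l-\nu}}{dx^{l-\nu}}\big(\sigma(x)^{l-\nu}w(x){\cal P}_\nu(x;l)\big)$; they are constructed from ${\cal P}_0(x;l)\equiv1$ by ${\cal P}_{\nu+1}(x;l)=\sigma(x)\frac{d}{dx}{\cal P}_\nu(x;l)+[\tau(x)+(l-\nu-1)\sigma'(x)]{\cal P}_\nu(x;l)$, and are given by ${\cal P}_\nu(x;l)=w(x)^{-1}\sigma(x)^{\nu-l}\frac{d^\nu}{dx^\nu}[w(x)\sigma(x)^l]$, $\nu=0,1,2,\dots$. In particular ${\cal P}_1(x;l)=\tau(x)+(l-1)\sigma'(x)$. Their generating function $\sum_{\nu\ge0}\frac{y^\nu}{\nu!}{\cal P}_\nu(x;l)$ has the closed form $\frac{w(x+y\sigma(x))}{w(x)}\Big(\frac{\sigma(x+y\sigma(x))}{\sigma(x)}\Big)^l$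 for small $|y|$. *)

theory Defs
  imports "HOL-Analysis.Analysis" "HOL-Computational_Algebra.Polynomial"
begin

text \<open>
  The end points are extended reals, so the fundamental interval may be unbounded.
  The weight and the polynomials are those of one fixed value of the parameter \<open>l\<close>; since
  the weight, \<open>\<sigma>\<close> and \<open>\<tau>\<close> are arbitrary, any dependence of them on \<open>l\<close> is covered.
\<close>

locale pearson_weight =
  fixes \<sigma> \<tau> :: "real poly" and w :: "real \<Rightarrow> real" and a b :: ereal
  assumes degree_sigma: "degree \<sigma> \<le> 2"
    and degree_tau: "degree \<tau> \<le> 1"
    and interval: "a < b"
    and sigma_nonzero: "\<And>x. x \<in> einterval a b \<Longrightarrow> poly \<sigma> x \<noteq> 0"
    and w_nonzero: "\<And>x. x \<in> einterval a b \<Longrightarrow> w x \<noteq> 0"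
    and w_differentiable: "\<And>x. x \<in> einterval a b \<Longrightarrow> w differentiable (at x)"
    and pearson: "\<And>x. x \<in> einterval a b \<Longrightarrow>
          poly \<sigma> x * deriv w x = (poly \<tau> x - poly (pderiv \<sigma>) x) * w x"

text \<open>
  \<open>compl_poly \<sigma> \<tau> l \<nu>\<close> is the complementary polynomial with index \<open>\<nu>\<close> and parameter \<open>l\<close>.
  Changing \<open>l\<close> in it leaves \<open>\<tau>\<close> (and hence the weight) unchanged; only the exponent of
  \<open>\<sigma>\<close> in the Rodrigues formula changes. The weight enters through the two Rodrigues
  representations proved at the end of this theory.
\<close>

primrec compl_poly :: "real poly \<Rightarrow> real poly \<Rightarrow> nat \<Rightarrow> nat \<Rightarrow> real poly" where
  "compl_poly \<sigma> \<tau> l 0 = 1"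
| "compl_poly \<sigma> \<tau> l (Suc \<nu>) =
     \<sigma> * pderiv (compl_poly \<sigma> \<tau> l \<nu>)
     + (\<tau> + smult (real l - real \<nu> - 1) (pderiv \<sigma>)) * compl_poly \<sigma> \<tau> l \<nu>"

lemma higher_deriv_cong_open:
  fixes f g :: "real \<Rightarrow> real"
  assumes "open S" "\<And>x. x \<in> S \<Longrightarrow> f x = g x" "x \<in> S"
  shows "(deriv ^^ n) f x = (deriv ^^ n) g x"
  using assms(3)
proof (induction n arbitrary: x)
  case (Suc n)
  have "\<forall>\<^sub>F y in nhds x. (deriv ^^ n) f y = (deriv ^^ n) g y"
    using assms(1) Suc unfolding eventually_nhds by blast
  then show ?case by (simp add: deriv_cong_ev)
qed (use assms in auto)

context pearson_weight
begin

lemma w_has_deriv: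
  assumes "x \<in> einterval a b"
  shows "(w has_real_derivative
           (poly \<tau> x - poly (pderiv \<sigma>) x) * w x / poly \<sigma> x) (at x)"
proof -
  have "(w has_real_derivative deriv w x) (at x)"
    using w_differentiable[OF assms]
    by (metis DERIV_imp_deriv real_differentiable_def)
  moreover have "deriv w x = (poly \<tau> x - poly (pderiv \<sigma>) x) * w x / poly \<sigma> x"
    using pearson[OF assms] sigma_nonzero[OF assms] by (simp add: field_simps)
  ultimately show ?thesis by simp
qed

lemma higher_deriv_weight:
  assumes "x \<in> einterval a b"
  shows "(deriv ^^ \<nu>) (\<lambda>t. w t * poly \<sigma> t ^ l) x
       = w x * poly \<sigma> x powi (int l - int \<nu>) * poly (compl_poly \<sigma> \<tau> l \<nu>) x"
  using assms
proof (induction \<nu> arbitrary: x)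
  case 0
  then show ?case by simp
next
  case (Suc \<nu>)
  let ?k = "int l - int \<nu>" and ?P = "compl_poly \<sigma> \<tau> l \<nu>"
  have s: "poly \<sigma> x \<noteq> 0" using sigma_nonzero Suc by blast
  have "\<forall>\<^sub>F y in nhds x. (deriv ^^ \<nu>) (\<lambda>t. w t * poly \<sigma> t ^ l) y
        = w y * poly \<sigma> y powi ?k * poly ?P y"
    using Suc open_einterval[of a b] unfolding eventually_nhds by blast
  then have "(deriv ^^ Suc \<nu>) (\<lambda>t. w t * poly \<sigma> t ^ l) x
        = deriv (\<lambda>y. w y * poly \<sigma> y powi ?k * poly ?P y) x"
    by (simp add: deriv_cong_ev)
  also have "\<dots> = w x * poly \<sigma> x powi (?k - 1) * poly (compl_poly \<sigma> \<tau> l (Suc \<nu>)) x"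
  proof (rule DERIV_imp_deriv)
    have pk: "poly \<sigma> x powi ?k = poly \<sigma> x powi (?k - 1) * poly \<sigma> x"
      using s by (simp add: power_int_diff)
    have dk: "((\<lambda>y. poly \<sigma> y powi ?k) has_real_derivative
        of_int ?k * poly \<sigma> x powi (?k - 1) * poly (pderiv \<sigma>) x) (at x)"
      by (rule DERIV_power_int[OF poly_DERIV]) (use s in simp)
    show "((\<lambda>y. w y * poly \<sigma> y powi ?k * poly ?P y) has_real_derivative
        w x * poly \<sigma> x powi (?k - 1) * poly (compl_poly \<sigma> \<tau> l (Suc \<nu>)) x) (at x)"
      by (rule DERIV_cong[OF DERIV_mult[OF DERIV_mult[OF w_has_deriv[OF Suc.prems] dk] poly_DERIV]])
        (use s in \<open>simp add: pk divide_simps, simp add: algebra_simps\<close>)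
  qed
  finally show ?case by (simp add: algebra_simps)
qed

lemma compl_poly_rodrigues:
  assumes "x \<in> einterval a b"
  shows "poly (compl_poly \<sigma> \<tau> l \<nu>) x
       = inverse (w x) * poly \<sigma> x powi (int \<nu> - int l)
         * (deriv ^^ \<nu>) (\<lambda>t. w t * poly \<sigma> t ^ l) x"
  using w_nonzero[OF assms] sigma_nonzero[OF assms]
  by (simp add: higher_deriv_weight[OF assms] power_int_diff)

lemma compl_poly_introduction:
  assumes "x \<in> einterval a b" "\<nu> \<le> l"
  shows "1 / w x * (deriv ^^ l) (\<lambda>t. poly \<sigma> t ^ l * w t) x
       = 1 / w x * (deriv ^^ (l - \<nu>))
           (\<lambda>t. poly \<sigma> t ^ (l - \<nu>) * w t * poly (compl_poly \<sigma> \<tau> l \<nu>) t) x"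
proof -
  have "(deriv ^^ l) (\<lambda>t. poly \<sigma> t ^ l * w t) x
      = (deriv ^^ (l - \<nu>)) ((deriv ^^ \<nu>) (\<lambda>t. w t * poly \<sigma> t ^ l)) x"
    using assms(2) by (metis (no_types, lifting) comp_apply ext funpow_add le_add_diff_inverse2 mult.commute)
  also have "\<dots> = (deriv ^^ (l - \<nu>))
           (\<lambda>t. poly \<sigma> t ^ (l - \<nu>) * w t * poly (compl_poly \<sigma> \<tau> l \<nu>) t) x"
    by (rule higher_deriv_cong_open[OF open_einterval _ assms(1)])
      (use assms(2) in \<open>simp add: higher_deriv_weight flip: of_nat_diff\<close>)
  finally show ?thesis by simp
qed

end

end

theory Submission
  imports Defs
begin

text \<open>
  Since \<open>\<sigma>''\<close> and \<open>\<tau>'\<close> are constant, the derivative of a complementary polynomial is a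
  constant multiple of the preceding one,
  \<open>P\<^sub>\<nu>\<^sub>+\<^sub>1' = (\<nu> + 1) (\<tau>' + (l - 1 - \<nu> / 2) \<sigma>'') P\<^sub>\<nu>\<close>. Inserting this into the defining
  recursion gives (1). Relation (2) says that \<open>D\<^sub>\<nu> = \<sigma> d/dx + \<tau> + (l - \<nu> - 1) \<sigma>'\<close> maps its
  right-hand side for \<open>\<nu> - 1\<close> to the one for \<open>\<nu>\<close>. In (3), the derivatives with index \<open>\<nu>\<close> and
  \<open>\<nu> - 1\<close> are eliminated by the derivative formula, the one with index \<open>\<nu> - 2\<close> by the
  defining recursion.
\<close>

lemma pderiv_eq_0_if_degree_le:
  fixes p :: "real poly"
  shows "degree p \<le> 1 \<Longrightarrow> pderiv (pderiv p) = 0"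
    and "degree p \<le> 2 \<Longrightarrow> pderiv (pderiv (pderiv p)) = 0"
  by (simp_all add: pderiv_eq_0_iff degree_pderiv)

context
  fixes \<sigma> \<tau> :: "real poly"
  assumes sigma''': "pderiv (pderiv (pderiv \<sigma>)) = 0"
    and tau'': "pderiv (pderiv \<tau>) = 0"
begin

text \<open>The induction closes because the factor in front of
  \<open>compl_poly \<sigma> \<tau> l n\<close> is constant: differentiating the recursion then
  gives the recursion back, times that factor.\<close>

lemma pderiv_compl_poly_Suc:
  "pderiv (compl_poly \<sigma> \<tau> l (Suc n))
   = smult (real (Suc n))
       ((pderiv \<tau> + smult (real l - 1 - real n / 2) (pderiv (pderiv \<sigma>))) * compl_poly \<sigma> \<tau> l n)"
proof (induction n)
  case 0
  then show ?case by (simp add: pderiv_add pderiv_smult)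
next
  case (Suc n)
  let ?P = "compl_poly \<sigma> \<tau> l"
  define L where
    "L = smult (real (Suc n)) (pderiv \<tau> + smult (real l - 1 - real n / 2) (pderiv (pderiv \<sigma>)))"
  have P': "pderiv (?P (Suc n)) = L * ?P n"
    using Suc by (simp add: L_def)
  have L': "pderiv L = 0"
    by (simp add: L_def pderiv_add pderiv_smult sigma''' tau'')
  \<comment> \<open>Differentiating the factor \<open>\<sigma>\<close> contributes an extra
    \<open>pderiv \<sigma> * L * ?P n\<close>, which raises the coefficient \<open>l - n - 2\<close>
    to \<open>l - n - 1\<close>; the terms with \<open>L\<close> thus recombine to
    \<open>L * ?P (Suc n)\<close>.\<close>
  have "pderiv (?P (Suc (Suc n)))
      = L * ?P (Suc n)
        + (pderiv \<tau> + smult (real l - real (Suc n) - 1) (pderiv (pderiv \<sigma>))) * ?P (Suc n)"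
    unfolding compl_poly.simps(2)[of \<sigma> \<tau> l "Suc n"]
    by (simp only: pderiv_add pderiv_mult pderiv_smult P' L', rule poly_ext)
      (simp add: algebra_simps)
  \<comment> \<open>For the second derivative of \<open>\<sigma>\<close> this is
    \<open>(n+1)(l-1-n/2) + (l-2-n) = (n+2)(l-1-(n+1)/2)\<close>.\<close>
  also have "\<dots> = smult (real (Suc (Suc n)))
       ((pderiv \<tau> + smult (real l - 1 - real (Suc n) / 2) (pderiv (pderiv \<sigma>))) * ?P (Suc n))"
    unfolding L_def by (rule poly_ext) (simp add: field_simps del: compl_poly.simps)
  finally show ?case .
qed

text \<open>Relation (1) at \<open>\<nu> = Suc n\<close>, which avoids a truncated index.\<close>

lemma compl_poly_Suc_Suc:
  "compl_poly \<sigma> \<tau> l (Suc (Suc n))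
   = (\<tau> + smult (real l - 2 - real n) (pderiv \<sigma>)) * compl_poly \<sigma> \<tau> l (Suc n)
     + smult (real (Suc n)) (\<sigma> * (pderiv \<tau> + smult (real l - 1 - real n / 2) (pderiv (pderiv \<sigma>)))
         * compl_poly \<sigma> \<tau> l n)"
  unfolding compl_poly.simps(2)[of \<sigma> \<tau> l "Suc n"] pderiv_compl_poly_Suc
  by (rule poly_ext) (simp add: algebra_simps)

lemma compl_poly_Suc_param:
  "compl_poly \<sigma> \<tau> (Suc l) (Suc (Suc n))
   = (\<tau> + smult (real l) (pderiv \<sigma>)) * compl_poly \<sigma> \<tau> l (Suc n)
     + smult (real (Suc n))
         (\<sigma> * (pderiv \<tau> + smult (real l) (pderiv (pderiv \<sigma>))) * compl_poly \<sigma> \<tau> l n)"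
proof (induction n)
  case 0
  show ?case
    by (rule poly_ext) (simp add: pderiv_add pderiv_smult pderiv_mult algebra_simps)
next
  case (Suc n)
  let ?Q = "compl_poly \<sigma> \<tau> l"
  define A where "A = \<tau> + smult (real l) (pderiv \<sigma>)"
  define k where "k = pderiv \<tau> + smult (real l) (pderiv (pderiv \<sigma>))"
  have A': "pderiv A = k"
    by (simp add: A_def k_def pderiv_add pderiv_smult)
  have k': "pderiv k = 0"
    by (simp add: k_def pderiv_add pderiv_smult sigma''' tau'')
  have IH: "compl_poly \<sigma> \<tau> (Suc l) (Suc (Suc n))
      = A * ?Q (Suc n) + smult (real (Suc n)) (\<sigma> * k * ?Q n)"
    using Suc by (simp only: A_def k_def)
  \<comment> \<open>The operator here has coefficient \<open>l - n - 2\<close>, exactly the one that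
    takes \<open>?Q (Suc n)\<close> to \<open>?Q (Suc (Suc n))\<close>. On
    \<open>\<sigma> * k * ?Q n\<close> the derivative of \<open>\<sigma>\<close> raises it to
    \<open>l - n - 1\<close>, as needed to reach \<open>?Q (Suc n)\<close>. The derivative of
    \<open>A\<close> supplies the one further copy of
    \<open>\<sigma> * k * ?Q (Suc n)\<close>.\<close>
  have "compl_poly \<sigma> \<tau> (Suc l) (Suc (Suc (Suc n)))
      = A * (\<sigma> * pderiv (?Q (Suc n)) + (\<tau> + smult (real l - real (Suc n) - 1) (pderiv \<sigma>)) * ?Q (Suc n))
        + \<sigma> * k * ?Q (Suc n)
        + smult (real (Suc n)) (\<sigma> * k
          * (\<sigma> * pderiv (?Q n) + (\<tau> + smult (real l - real n - 1) (pderiv \<sigma>)) * ?Q n))"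
    unfolding compl_poly.simps(2)[of \<sigma> \<tau> "Suc l" "Suc (Suc n)"] IH
    by (rule poly_ext)
      (simp add: pderiv_add pderiv_mult pderiv_smult A' k' algebra_simps del: compl_poly.simps)
  also have "\<dots> = A * ?Q (Suc (Suc n)) + smult (real (Suc (Suc n))) (\<sigma> * k * ?Q (Suc n))"
    unfolding compl_poly.simps(2)[symmetric]
    by (rule poly_ext) (simp add: algebra_simps del: compl_poly.simps)
  finally show ?case by (simp only: A_def k_def)
qed

end

(* A term with index nu - 1 or nu - 2 has a factor that vanishes whenever that index
   would be negative, so truncated subtraction realizes the convention that it is 0. *)
theorem theorem5:
  fixes \<sigma> \<tau> :: "real poly" and w :: "real \<Rightarrow> real" and a b :: ereal
    and l \<nu> :: nat and x :: real
  assumes "pearson_weight \<sigma> \<tau> w a b"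
  shows
    "(let P = (\<lambda>k n. poly (compl_poly \<sigma> \<tau> k n) x);
          P' = (\<lambda>k n. poly (pderiv (compl_poly \<sigma> \<tau> k n)) x);
          s = poly \<sigma> x; s' = poly (pderiv \<sigma>) x; s'' = poly (pderiv (pderiv \<sigma>)) x;
          t = poly \<tau> x; t' = poly (pderiv \<tau>) x
      in
        P l (\<nu> + 1)
          = (t + (real l - 1 - real \<nu>) * s') * P l \<nu>
            + real \<nu> * s * (t' + (real l - 1 - 1 / 2 * (real \<nu> - 1)) * s'') * P l (\<nu> - 1)
      \<and>
        (l \<ge> 1 \<longrightarrow>
          P l (\<nu> + 1)
            = (t + (real l - 1) * s') * P (l - 1) \<nu>
              + real \<nu> * s * (t' + (real l - 1) * s'') * P (l - 1) (\<nu> - 1)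
        \<and> P l (\<nu> + 1)
            = P l 1 * P (l - 1) \<nu> + real \<nu> * s * P' l 1 * P (l - 1) (\<nu> - 1))
      \<and>
        1 / 2 * real \<nu> * (real \<nu> - 1) * s'' * s * P' l (\<nu> - 2)
            + real \<nu> * s' * P' l (\<nu> - 1) + P' l \<nu>
          = real \<nu> * (t' + (real l - 1) * s'') * P l (\<nu> - 1)
            + real \<nu> * (real \<nu> - 1) * P l (\<nu> - 2)
              * (s' * (t' + (real l - 1) * s'') - 1 / 2 * s'' * (t + (real l - 1) * s'))
      \<and>
        1 / 2 * real \<nu> * (real \<nu> - 1) * s'' * s * P' l (\<nu> - 2)
            + real \<nu> * s' * P' l (\<nu> - 1) + P' l \<nu>
          = real \<nu> * P' l 1 * P l (\<nu> - 1)
            + real \<nu> * (real \<nu> - 1) * P l (\<nu> - 2)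
              * (s' * P' l 1 - 1 / 2 * s'' * P l 1))"
proof -
  interpret pearson_weight \<sigma> \<tau> w a b by fact
  note s3 = pderiv_eq_0_if_degree_le(2)[OF degree_sigma]
  note t2 = pderiv_eq_0_if_degree_le(1)[OF degree_tau]
  define P where "P = (\<lambda>k n. poly (compl_poly \<sigma> \<tau> k n) x)"
  define P' where "P' = (\<lambda>k n. poly (pderiv (compl_poly \<sigma> \<tau> k n)) x)"
  define s where "s = poly \<sigma> x"
  define s' where "s' = poly (pderiv \<sigma>) x"
  define s'' where "s'' = poly (pderiv (pderiv \<sigma>)) x"
  define t where "t = poly \<tau> x"
  define t' where "t' = poly (pderiv \<tau>) x"
  note defs = P_def P'_def s_def s'_def s''_def t_def t'_def
  have P_0: "P k 0 = 1" "P' k 0 = 0" for k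
    by (simp_all add: defs)
  have P_1: "P k (Suc 0) = t + (real k - 1) * s'" "P' k (Suc 0) = t' + (real k - 1) * s''" for k
    by (simp_all add: defs pderiv_add pderiv_smult)
  have P_Suc: "P k (Suc n) = s * P' k n + (t + (real k - real n - 1) * s') * P k n" for k n
    by (simp add: defs)
  have P'_Suc: "P' k (Suc n) = real (Suc n) * (t' + (real k - 1 - real n / 2) * s'') * P k n" for k n
    by (simp add: defs pderiv_compl_poly_Suc[OF s3 t2] del: compl_poly.simps)
  have first: "P l (\<nu> + 1) = (t + (real l - 1 - real \<nu>) * s') * P l \<nu>
      + real \<nu> * s * (t' + (real l - 1 - 1 / 2 * (real \<nu> - 1)) * s'') * P l (\<nu> - 1)"
  proof (cases \<nu>)
    case 0
    then show ?thesis by (simp add: P_0 P_1)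
  next
    case (Suc n)
    then show ?thesis
      by (simp add: defs compl_poly_Suc_Suc[OF s3 t2] algebra_simps del: compl_poly.simps)
  qed
  have second: "P l (\<nu> + 1) = (t + (real l - 1) * s') * P (l - 1) \<nu>
      + real \<nu> * s * (t' + (real l - 1) * s'') * P (l - 1) (\<nu> - 1)" if l: "l \<ge> 1"
  proof (cases \<nu>)
    case 0
    then show ?thesis by (simp add: P_0 P_1)
  next
    case (Suc n)
    obtain m where "l = Suc m"
      using l by (cases l) auto
    with Suc show ?thesis
      by (simp add: defs compl_poly_Suc_param[OF s3 t2] del: compl_poly.simps)
  qed
  have third: "1 / 2 * real \<nu> * (real \<nu> - 1) * s'' * s * P' l (\<nu> - 2)
        + real \<nu> * s' * P' l (\<nu> - 1) + P' l \<nu>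
      = real \<nu> * (t' + (real l - 1) * s'') * P l (\<nu> - 1)
        + real \<nu> * (real \<nu> - 1) * P l (\<nu> - 2)
          * (s' * (t' + (real l - 1) * s'') - 1 / 2 * s'' * (t + (real l - 1) * s'))"
  proof -
    consider "\<nu> = 0" | "\<nu> = 1" | n where "\<nu> = Suc (Suc n)"
      by (metis One_nat_def old.nat.exhaust)
    then show ?thesis
    proof cases
      case 3
      then show ?thesis
        \<comment> \<open>The two sides differ in their \<open>P l (Suc n)\<close> terms by a
          multiple of \<open>s''\<close>; expanding \<open>P l (Suc n)\<close> there by the
          recursion cancels \<open>P' l n\<close>.\<close>
        by (simp add: P'_Suc P_Suc) (simp add: field_simps)
    qed (simp_all add: P_0 P_1)
  qed
  \<comment> \<open>Rewriting the index-1 polynomial and its derivative turns the second forms of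
    (2) and (3) into the first.\<close>
  note P_1' = P_1[unfolded defs, folded One_nat_def]
  show ?thesis
    using first second third unfolding Let_def defs P_1' by blast
qed

end
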